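(* Let $y=A\widetilde{x}+\eta$, where $\widetilde{x}\in[-d,d]^n$ has support $S$ with $|S|=k$, let $\lambda>0$, and let $x^\star\in[-d,d]^n$ be the candidate point defined in the context. Assume that $$\|(A_S^\top A_S-\lambda I)^{-1}\|_{\infty}\left[\lambda d(1-\mu)+\|A_S^\top\eta\|_{\infty}\right]\leq \mu d .$$ Suppose that the following conditions hold for some $\omega>0$, $\alpha>0$, $\phi>0$: (C1) $A$ satisfies the $(\omega,S)$-irrepresentable condition, i.e. $\|A_S^{\dagger}A_{\bar S}\|_1<\frac{1}{\omega}$; (C2) $A$ satisfies the $(\alpha,\phi,S)$-restricted eigenvalue condition with $\phi>\lambda$; (C3) for some (arbitrarily small) $\varepsilon>0$, $$\lambda d-\frac{1}{\omega}\left\|A_S^\top A_S(A_S^\top A_S-\lambda I)^{-1}\right\|_{\infty}\left[\lambda d(1-\mu)+\|A_S^\top\eta\|_{\infty}\right]-\left\|A_{\bar S}^\top\eta\right\|_{\infty}>\lambda\varepsilon\frac{1+\alpha}{\alpha}.$$ Then $x^\star$ is a local minimum (local minimizer) of $\mathcal{F}(x)$, $x\in[-d,d]^n$.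
   Context: Setting. $A\in\mathbb{R}^{m\times n}$ with $m<n$, $\eta\in\mathbb{R}^m$ (noise), $\widetilde{x}\in\mathbb{R}^n$ with support $S\subset\{1,\dots,n\}$ (the set of indices of its non-zero components), $\bar S$ the complement of $S$, $|S|=k$, $1\le k\leq m$. The constant $d>0$ satisfies $|\widetilde{x}_i|\le d$ for all $i$. For $v\in\mathbb{R}^n$, $v_S$ is the subvector of components indexed by $S$; $A_S$ is the submatrix of columns of $A$ indexed by $S$ (similarly for $\bar S$). $A_S$ has full rank, so $A_S^\top A_S$ is invertible, and $A_S^{\dagger}=(A_S^\top A_S)^{-1}A_S^\top$. The parameter $\lambda>0$ is such that $A_S^\top A_S-\lambda I$ is positive definite (in particular invertible). Set $\mu=\frac1d\min_{i\in S}|\widetilde{x}_i|\in(0,1]$. The function $\mathrm{sign}$ acts componentwise. For vectors $\|\cdot\|_1,\|\cdot\|_2,\|\cdot\|_\infty$ are the usual norms; for matrices $\|\cdot\|_1$ and $\|\cdot\|_\infty$ are the induced norms (maximum absolute column sum, maximum absolute row sum). Functional: $\mathcal{F}(x)=\frac12\|y-Ax\|_2^2+\lambda\left(d\|x\|_1-\frac12\|x\|_2^2\right)$, to be minimized over $x\in[-d,d]^n$, with $y=A\widetilde{x}+\eta$. Restricted eigenvalue condition: $A$ satisfies $(\alpha,\phi,S)$-RE if $\|Av\|_2^2\ge\phi\|v\|_2^2$ for every non-zero $v\in\mathcal{C}(\alpha,S)=\{x\in\mathbb{R}^n:\|x_{\bar S}\|_1\le\alpha\|x_S\|_1\}$.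 Candidate point: $x^\star\in[-d,d]^n$ is the vector with $x^\star_{\bar S}=0$ and $$x^\star_S=\widetilde{x}_S+(A_S^\top A_S-\lambda I)^{-1}\left[\lambda\widetilde{x}_S-\lambda d\,\mathrm{sign}(x^\star_S)+A_S^\top\eta\right].$$ *)

theory Defs
  imports "HOL-Analysis.Analysis"
begin

text \<open>
  A set \<open>S\<close> of column indices is presented by a bijective enumeration \<open>s :: 'k \<Rightarrow> 'n\<close> of \<open>S\<close>
  by a finite index type \<open>'k\<close>, so that \<open>v\<^sub>S\<close> and \<open>A\<^sub>S\<close> are a genuine vector in \<open>real ^ 'k\<close> and a
  genuine matrix with \<open>CARD('k)\<close> columns. The choice of enumeration only permutes components
  and columns.
\<close>

definition subvec :: "('k::finite \<Rightarrow> 'n::finite) \<Rightarrow> real ^ 'n \<Rightarrow> real ^ 'k" where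
  "subvec s v = (\<chi> i. v $ s i)"

definition subcols :: "('k::finite \<Rightarrow> 'n::finite) \<Rightarrow> real ^ 'n ^ 'm \<Rightarrow> real ^ 'k ^ 'm" where
  "subcols s A = (\<chi> i j. A $ i $ s j)"

text \<open>Componentwise sign; the library's \<open>sgn\<close> on vectors is normalisation instead.\<close>

definition sign_vec :: "real ^ 'k \<Rightarrow> real ^ 'k" where
  "sign_vec v = (\<chi> i. sgn (v $ i))"

text \<open>The vector norms \<open>\<parallel>\<cdot>\<parallel>\<^sub>2\<close> and \<open>\<parallel>\<cdot>\<parallel>\<^sub>\<infinity>\<close> are the library's \<open>norm\<close> and \<open>infnorm\<close>.\<close>

definition l1norm :: "real ^ 'n \<Rightarrow> real" where
  "l1norm v = (\<Sum>i\<in>UNIV. \<bar>v $ i\<bar>)"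

definition mat_norm_1 :: "real ^ 'n ^ 'm \<Rightarrow> real" where
  "mat_norm_1 N = Max (range (\<lambda>j. \<Sum>i\<in>UNIV. \<bar>N $ i $ j\<bar>))"

definition mat_norm_inf :: "real ^ 'n ^ 'm \<Rightarrow> real" where
  "mat_norm_inf N = Max (range (\<lambda>i. \<Sum>j\<in>UNIV. \<bar>N $ i $ j\<bar>))"

definition pos_def :: "real ^ 'k ^ 'k \<Rightarrow> bool" where
  "pos_def M \<longleftrightarrow> transpose M = M \<and> (\<forall>v. v \<noteq> 0 \<longrightarrow> v \<bullet> (M *v v) > 0)"

definition gram :: "real ^ 'k ^ 'm \<Rightarrow> real ^ 'k ^ 'k" where
  "gram B = transpose B ** B"

definition shifted_gram :: "real \<Rightarrow> real ^ 'k ^ 'm \<Rightarrow> real ^ 'k ^ 'k" where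
  "shifted_gram lam B = gram B - lam *\<^sub>R mat 1"

text \<open>Left pseudo-inverse, meaningful for matrices of full column rank.\<close>

definition pinv :: "real ^ 'k ^ 'm \<Rightarrow> real ^ 'm ^ 'k" where
  "pinv B = matrix_inv (gram B) ** transpose B"

text \<open>Here \<open>s\<close> enumerates \<open>S\<close> and \<open>t\<close> enumerates its complement.\<close>

definition irrepresentable ::
  "real \<Rightarrow> ('k::finite \<Rightarrow> 'n::finite) \<Rightarrow> ('l::finite \<Rightarrow> 'n) \<Rightarrow> real ^ 'n ^ 'm \<Rightarrow> bool" where
  "irrepresentable \<omega> s t A \<longleftrightarrow> mat_norm_1 (pinv (subcols s A) ** subcols t A) < 1 / \<omega>"

definition re_cone :: "real \<Rightarrow> 'n::finite set \<Rightarrow> (real ^ 'n) set" where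
  "re_cone \<alpha> S = {x. (\<Sum>i\<in>- S. \<bar>x $ i\<bar>) \<le> \<alpha> * (\<Sum>i\<in>S. \<bar>x $ i\<bar>)}"

definition restricted_eigenvalue ::
  "real \<Rightarrow> real \<Rightarrow> 'n::finite set \<Rightarrow> real ^ 'n ^ 'm \<Rightarrow> bool" where
  "restricted_eigenvalue \<alpha> \<phi> S A \<longleftrightarrow>
     (\<forall>v \<in> re_cone \<alpha> S. v \<noteq> 0 \<longrightarrow> (norm (A *v v))\<^sup>2 \<ge> \<phi> * (norm v)\<^sup>2)"

definition objective ::
  "real ^ 'n ^ 'm \<Rightarrow> real ^ 'm \<Rightarrow> real \<Rightarrow> real \<Rightarrow> real ^ 'n \<Rightarrow> real" where
  "objective A y lam d x =
     1/2 * (norm (y - A *v x))\<^sup>2 + lam * (d * l1norm x - 1/2 * (norm x)\<^sup>2)"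

definition local_minimizer_on ::
  "'a::metric_space set \<Rightarrow> ('a \<Rightarrow> real) \<Rightarrow> 'a \<Rightarrow> bool" where
  "local_minimizer_on X f x \<longleftrightarrow>
     x \<in> X \<and> (\<exists>r>0. \<forall>z\<in>X. dist z x < r \<longrightarrow> f x \<le> f z)"

end

theory Submission
  imports Defs
begin

text \<open>
  Write \<open>M = A\<^sub>S\<^sup>T A\<^sub>S - \<lambda> I\<close>. The defining equation of \<open>x\<^sup>\<star>\<close> says that \<open>x\<^sup>\<star>\<^sub>S\<close> is a stationary
  point of the objective restricted to vectors supported on \<open>S\<close>. That restricted objective is a
  quadratic with Hessian \<open>M\<close> plus the convex term \<open>\<lambda> d \<parallel>\<cdot>\<parallel>\<^sub>1\<close>, hence is strictly convex and has only
  one stationary point (\<open>pos_def_l1_stationary_unique\<close>). The bound by \<open>\<mu> d\<close> makes the vector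
  obtained by putting \<open>sign(xt\<^sub>S)\<close> in place of \<open>sign(x\<^sup>\<star>\<^sub>S)\<close> on the right-hand side stationary as
  well, so the two vectors coincide. Since \<open>\<lambda> d > 0\<close>, it follows that
  \<open>sign(x\<^sup>\<star>\<^sub>S) = sign(xt\<^sub>S)\<close> (\<open>candidate_sign_eq\<close>), and the bracket in the defining equation is bounded
  in the maximum norm by \<open>\<lambda> d (1 - \<mu>) + \<parallel>A\<^sub>S\<^sup>T \<eta>\<parallel>\<^sub>\<infinity>\<close>.

  Off \<open>S\<close>, the identity \<open>A\<^sub>T\<^sup>T A\<^sub>S = (A\<^sub>S\<^sup>\<dagger> A\<^sub>T)\<^sup>T A\<^sub>S\<^sup>T A\<^sub>S\<close>, where \<open>T\<close> is the complement of \<open>S\<close>, turns the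
  irrepresentable condition and the last inequality assumed into the dual bound
  \<open>\<parallel>A\<^sub>T\<^sup>T (y - A x\<^sup>\<star>)\<parallel>\<^sub>\<infinity> < \<lambda> d - \<lambda> \<epsilon> (1 + \<alpha>) / \<alpha>\<close>.

  The objective is quadratic plus \<open>\<lambda> d \<parallel>\<cdot>\<parallel>\<^sub>1\<close>, and so its increment along \<open>h\<close> is at least
  \<open>(\<parallel>A h\<parallel>\<^sup>2 - \<lambda> \<parallel>h\<parallel>\<^sup>2) / 2 + \<lambda> \<epsilon> (1 + \<alpha>) / \<alpha> \<parallel>h\<^sub>T\<parallel>\<^sub>1\<close>. On the cone \<open>\<C>(\<alpha>, S)\<close> the
  restricted eigenvalue condition with \<open>\<phi> > \<lambda>\<close> makes this nonnegative. Off the cone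
  \<open>\<parallel>h\<parallel>\<^sub>2 \<le> \<parallel>h\<parallel>\<^sub>1 \<le> (1 + \<alpha>) / \<alpha> \<parallel>h\<^sub>T\<parallel>\<^sub>1\<close>, and the last term outweighs \<open>\<lambda> \<parallel>h\<parallel>\<^sup>2 / 2\<close> as soon as
  \<open>\<parallel>h\<parallel> < 2 \<epsilon>\<close> (\<open>objective_le_of_dual_certificate\<close>).
\<close>

section \<open>Inverses and induced norms of matrices\<close>

lemma matrix_inv_inverse:
  fixes N :: "real ^ 'k ^ 'k"
  assumes "invertible N"
  shows "N ** matrix_inv N = mat 1" "matrix_inv N ** N = mat 1"
proof -
  have "N ** matrix_inv N = mat 1 \<and> matrix_inv N ** N = mat 1"
    using assms unfolding invertible_def matrix_inv_def by (rule someI_ex)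
  then show "N ** matrix_inv N = mat 1" "matrix_inv N ** N = mat 1" by auto
qed

lemma invertible_if_quadratic_form_pos:
  fixes N :: "real ^ 'k ^ 'k"
  assumes "\<And>v. v \<noteq> 0 \<Longrightarrow> v \<bullet> (N *v v) > 0"
  shows "invertible N"
proof -
  have "\<forall>v. N *v v = 0 \<longrightarrow> v = 0"
    using assms by (metis inner_zero_right less_irrefl)
  then show ?thesis
    by (simp add: invertible_left_inverse matrix_left_invertible_ker)
qed

lemma infnorm_le_cart:
  fixes v :: "real ^ 'k"
  assumes "\<And>i. \<bar>v $ i\<bar> \<le> c"
  shows "infnorm v \<le> c"
  unfolding infnorm_cart by (rule cSup_least) (use assms in auto)

lemma mat_norm_inf_nonneg: "0 \<le> mat_norm_inf N"
proof -
  have "0 \<le> (\<Sum>j\<in>UNIV. \<bar>N $ undefined $ j\<bar>)"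
    by (simp add: sum_nonneg)
  also have "\<dots> \<le> mat_norm_inf N"
    unfolding mat_norm_inf_def by (rule Max_ge) auto
  finally show ?thesis .
qed

lemma abs_matrix_vector_le_mat_norm_inf:
  "\<bar>(N *v v) $ i\<bar> \<le> mat_norm_inf N * infnorm v"
proof -
  have "\<bar>(N *v v) $ i\<bar> \<le> (\<Sum>j\<in>UNIV. \<bar>N $ i $ j * v $ j\<bar>)"
    unfolding matrix_vector_mult_def by (simp add: sum_abs)
  also have "\<dots> \<le> (\<Sum>j\<in>UNIV. \<bar>N $ i $ j\<bar> * infnorm v)"
    by (intro sum_mono) (simp add: abs_mult component_le_infnorm_cart mult_left_mono)
  also have "\<dots> = (\<Sum>j\<in>UNIV. \<bar>N $ i $ j\<bar>) * infnorm v"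
    by (simp add: sum_distrib_right)
  also have "\<dots> \<le> mat_norm_inf N * infnorm v"
    unfolding mat_norm_inf_def
    by (intro mult_right_mono Max_ge) (auto simp: infnorm_pos_le)
  finally show ?thesis .
qed

lemma mat_norm_inf_transpose: "mat_norm_inf (transpose N) = mat_norm_1 N"
  by (simp add: mat_norm_inf_def mat_norm_1_def transpose_def)

section \<open>Submatrices of columns\<close>

lemma matrix_vector_split_subcols:
  fixes A :: "real ^ 'n::finite ^ 'm::finite"
    and s :: "'k::finite \<Rightarrow> 'n" and t :: "'l::finite \<Rightarrow> 'n"
  assumes "bij_betw s UNIV S" "bij_betw t UNIV (- S)"
  shows "A *v x = subcols s A *v subvec s x + subcols t A *v subvec t x"
proof -
  have "(\<Sum>j\<in>UNIV. A $ i $ j * x $ j)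
      = (\<Sum>j\<in>UNIV. A $ i $ s j * x $ s j) + (\<Sum>j\<in>UNIV. A $ i $ t j * x $ t j)" for i
  proof -
    have "(\<Sum>j\<in>UNIV. A $ i $ j * x $ j)
        = (\<Sum>j\<in>S. A $ i $ j * x $ j) + (\<Sum>j\<in>- S. A $ i $ j * x $ j)"
      by (subst sum.union_disjoint[symmetric]) auto
    then show ?thesis
      by (simp add: sum.reindex_bij_betw[OF assms(1), symmetric]
          sum.reindex_bij_betw[OF assms(2), symmetric])
  qed
  then show ?thesis
    by (simp add: vec_eq_iff matrix_vector_mult_def subcols_def subvec_def)
qed

lemma transpose_subcols_component:
  "(transpose (subcols s A) *v r) $ j = (transpose A *v r) $ s j"
  by (simp add: matrix_vector_mult_def transpose_def subcols_def
      del: transpose_matrix_vector)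

lemma shifted_gram_mult: "shifted_gram lam B *v v = gram B *v v - lam *\<^sub>R v"
  unfolding shifted_gram_def
  by (simp add: matrix_vector_mult_diff_rdistrib scaleR_matrix_vector_assoc[symmetric])

lemma invertible_gram_if_pos_def_shifted:
  assumes "pos_def (shifted_gram lam B)" "lam \<ge> 0"
  shows "invertible (gram B)"
proof (rule invertible_if_quadratic_form_pos)
  fix v :: "real ^ 'a" assume "v \<noteq> 0"
  then have "0 < v \<bullet> (shifted_gram lam B *v v)"
    using assms(1) unfolding pos_def_def by blast
  moreover have "0 \<le> lam * (v \<bullet> v)" using assms(2) by simp
  ultimately show "0 < v \<bullet> (gram B *v v)"
    by (simp add: shifted_gram_mult inner_diff_right)
qed

text \<open>
  The irrepresentable condition enters through this identity: correlations of the columns of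
  \<open>C\<close> with those of \<open>B\<close> factor through the regression coefficients \<open>B\<^sup>\<dagger> C\<close>.
\<close>

lemma transpose_pinv_mult_gram:
  fixes B :: "real ^ 'k ^ 'm" and C :: "real ^ 'l ^ 'm"
  assumes "invertible (gram B)"
  shows "transpose (pinv B ** C) ** gram B = transpose C ** B"
proof -
  let ?G = "gram B"
  have sym: "transpose ?G = ?G"
    by (simp add: gram_def matrix_transpose_mul)
  have "transpose (matrix_inv ?G) ** ?G = transpose (?G ** matrix_inv ?G)"
    by (simp add: matrix_transpose_mul sym)
  also have "\<dots> = mat 1"
    using matrix_inv_inverse(1)[OF assms] by simp
  finally have "transpose (matrix_inv ?G) ** ?G = mat 1" .
  then show ?thesis
    unfolding pinv_def
    by (simp add: matrix_transpose_mul matrix_mul_assoc[symmetric])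
qed

section \<open>Recovery of the signs on the support\<close>

lemma sgn_subgradient_abs: "\<bar>a\<bar> + sgn a * h \<le> \<bar>a + h\<bar>" for a h :: real
  by (cases "a = 0") (auto simp: sgn_if)

text \<open>
  The hypotheses on \<open>p\<close> and \<open>p'\<close> say that they are subgradients of the \<open>\<ell>\<^sub>1\<close> norm at \<open>u\<close> and \<open>u'\<close>;
  the proof combines monotonicity of that subdifferential with positivity of \<open>M\<close>.
\<close>

lemma pos_def_l1_stationary_unique:
  fixes M :: "real ^ 'k ^ 'k"
  assumes pd: "pos_def M" and "c \<ge> 0"
    and p: "\<And>i. \<bar>p $ i\<bar> \<le> 1" "\<And>i. p $ i * u $ i = \<bar>u $ i\<bar>"
    and p': "\<And>i. \<bar>p' $ i\<bar> \<le> 1" "\<And>i. p' $ i * u' $ i = \<bar>u' $ i\<bar>"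
    and eq: "M *v u + c *\<^sub>R p = M *v u' + c *\<^sub>R p'"
  shows "u = u'"
proof (rule ccontr)
  assume "u \<noteq> u'"
  then have "0 < (u - u') \<bullet> (M *v (u - u'))"
    using pd unfolding pos_def_def by simp
  also have "M *v (u - u') = - (c *\<^sub>R (p - p'))"
    using eq by (simp add: matrix_vector_mult_diff_distrib algebra_simps)
  also have "(u - u') \<bullet> (- (c *\<^sub>R (p - p'))) = - (c * ((u - u') \<bullet> (p - p')))"
    by simp
  finally have neg: "c * ((u - u') \<bullet> (p - p')) < 0" by simp
  have "0 \<le> (u $ i - u' $ i) * (p $ i - p' $ i)" for i
  proof -
    have "p' $ i * u $ i \<le> \<bar>u $ i\<bar>" "p $ i * u' $ i \<le> \<bar>u' $ i\<bar>"
      using mult_right_mono[OF p'(1)[of i], of "\<bar>u $ i\<bar>"]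
        mult_right_mono[OF p(1)[of i], of "\<bar>u' $ i\<bar>"]
      by (simp_all add: abs_mult[symmetric])
    then show ?thesis
      using p(2)[of i] p'(2)[of i] by (simp add: algebra_simps)
  qed
  then have "0 \<le> (u - u') \<bullet> (p - p')"
    unfolding inner_vec_def by (intro sum_nonneg) simp
  then show False using neg \<open>c \<ge> 0\<close> by (simp add: mult_less_0_iff)
qed

lemma infnorm_candidate_bracket_le:
  fixes w e :: "real ^ 'k"
  assumes "lam \<ge> 0" and w: "\<And>i. \<mu> * d \<le> \<bar>w $ i\<bar>" "\<And>i. \<bar>w $ i\<bar> \<le> d"
    and nz: "\<And>i. w $ i \<noteq> 0"
  shows "infnorm (lam *\<^sub>R w - (lam * d) *\<^sub>R sign_vec w + e) \<le> lam * d * (1 - \<mu>) + infnorm e"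
proof (rule infnorm_le_cart)
  fix i
  have "lam * w $ i - lam * d * sgn (w $ i) = lam * (w $ i - d * sgn (w $ i))"
    by (simp add: algebra_simps)
  then have "\<bar>lam * w $ i - lam * d * sgn (w $ i)\<bar> = lam * \<bar>w $ i - d * sgn (w $ i)\<bar>"
    using \<open>lam \<ge> 0\<close> by (simp add: abs_mult)
  also have "\<bar>w $ i - d * sgn (w $ i)\<bar> = d - \<bar>w $ i\<bar>"
    using nz[of i] w(2)[of i] by (auto simp: sgn_if)
  also have "lam * (d - \<bar>w $ i\<bar>) \<le> lam * (d - \<mu> * d)"
    using \<open>lam \<ge> 0\<close> w(1)[of i] by (intro mult_left_mono) auto
  finally have "\<bar>lam * w $ i - lam * d * sgn (w $ i)\<bar> \<le> lam * d * (1 - \<mu>)"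
    by (simp add: algebra_simps)
  then show "\<bar>(lam *\<^sub>R w - (lam * d) *\<^sub>R sign_vec w + e) $ i\<bar> \<le> lam * d * (1 - \<mu>) + infnorm e"
    using component_le_infnorm_cart[of e i] by (simp add: sign_vec_def)
qed

text \<open>
  Here \<open>u\<close>, \<open>w\<close> and \<open>e\<close> stand for \<open>x\<^sup>\<star>\<^sub>S\<close>, the part of the true signal on \<open>S\<close>, and \<open>A\<^sub>S\<^sup>T \<eta>\<close>. The equation
  for \<open>u\<close> is implicit in the signs of \<open>u\<close>; the conclusion is that these are the signs of \<open>w\<close>.
\<close>

lemma candidate_sign_eq:
  fixes M :: "real ^ 'k ^ 'k"
  assumes pd: "pos_def M" and "lam > 0" "d > 0"
    and w: "\<And>i. \<mu> * d \<le> \<bar>w $ i\<bar>" "\<And>i. \<bar>w $ i\<bar> \<le> d" and nz: "\<And>i. w $ i \<noteq> 0"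
    and u: "u = w + matrix_inv M *v (lam *\<^sub>R w - (lam * d) *\<^sub>R sign_vec u + e)"
    and bound: "mat_norm_inf (matrix_inv M) * (lam * d * (1 - \<mu>) + infnorm e) \<le> \<mu> * d"
  shows "sign_vec u = sign_vec w"
proof -
  define u' where "u' = w + matrix_inv M *v (lam *\<^sub>R w - (lam * d) *\<^sub>R sign_vec w + e)"
  have inv: "invertible M"
    using pd invertible_if_quadratic_form_pos unfolding pos_def_def by blast
  have Minv: "M *v (matrix_inv M *v v) = v" for v
    by (simp add: matrix_vector_mul_assoc matrix_inv_inverse(1)[OF inv])
  have Mu: "M *v u + (lam * d) *\<^sub>R sign_vec u = M *v w + lam *\<^sub>R w + e"
    by (subst u) (simp add: matrix_vector_right_distrib Minv)
  have Mu': "M *v u' + (lam * d) *\<^sub>R sign_vec w = M *v w + lam *\<^sub>R w + e"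
    by (simp add: u'_def matrix_vector_right_distrib Minv)
  have close: "\<bar>u' $ i - w $ i\<bar> \<le> \<mu> * d" for i
  proof -
    let ?q = "lam *\<^sub>R w - (lam * d) *\<^sub>R sign_vec w + e"
    have "\<bar>u' $ i - w $ i\<bar> = \<bar>(matrix_inv M *v ?q) $ i\<bar>"
      by (simp add: u'_def)
    also have "\<dots> \<le> mat_norm_inf (matrix_inv M) * infnorm ?q"
      by (rule abs_matrix_vector_le_mat_norm_inf)
    also have "\<dots> \<le> mat_norm_inf (matrix_inv M) * (lam * d * (1 - \<mu>) + infnorm e)"
      using \<open>lam > 0\<close> by (intro mult_left_mono infnorm_candidate_bracket_le w nz mat_norm_inf_nonneg) auto
    finally show ?thesis using bound by linarith
  qed
  \<comment> \<open>A component of \<open>u'\<close> may vanish, but cannot have the sign opposite to that of \<open>w\<close>.\<close>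
  have compat: "sign_vec w $ i * u' $ i = \<bar>u' $ i\<bar>" for i
    using close[of i] w(1)[of i] nz[of i] by (auto simp: sign_vec_def sgn_if)
  have "u = u'"
  proof (rule pos_def_l1_stationary_unique[OF pd])
    show "0 \<le> lam * d" using \<open>lam > 0\<close> \<open>d > 0\<close> by simp
    show "\<bar>sign_vec u $ i\<bar> \<le> 1" "\<bar>sign_vec w $ i\<bar> \<le> 1" for i
      by (simp_all add: sign_vec_def sgn_if)
    show "sign_vec u $ i * u $ i = \<bar>u $ i\<bar>" for i
      by (simp add: sign_vec_def sgn_if)
    show "sign_vec w $ i * u' $ i = \<bar>u' $ i\<bar>" for i by (rule compat)
    show "M *v u + (lam * d) *\<^sub>R sign_vec u = M *v u' + (lam * d) *\<^sub>R sign_vec w"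
      unfolding Mu Mu' ..
  qed
  with Mu Mu' have "(lam * d) *\<^sub>R sign_vec u = (lam * d) *\<^sub>R sign_vec w"
    by (metis add_left_cancel)
  then show ?thesis using \<open>lam > 0\<close> \<open>d > 0\<close> by simp
qed

section \<open>A sufficient condition for local minimality\<close>

lemma objective_increment:
  fixes A :: "real ^ 'n ^ 'm"
  shows "objective A y lam d (x + h) - objective A y lam d x =
    1/2 * (norm (A *v h))\<^sup>2 - lam / 2 * (norm h)\<^sup>2
    + (\<Sum>i\<in>UNIV. lam * d * (\<bar>x $ i + h $ i\<bar> - \<bar>x $ i\<bar>)
         - ((transpose A *v (y - A *v x)) $ i + lam * x $ i) * h $ i)"
proof -
  let ?r = "y - A *v x"
  have "y - A *v (x + h) = ?r - A *v h"
    by (simp add: matrix_vector_right_distrib)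
  then have 1: "(norm (y - A *v (x + h)))\<^sup>2 = (norm ?r)\<^sup>2 - 2 * (?r \<bullet> (A *v h)) + (norm (A *v h))\<^sup>2"
    by (simp only:) (simp add: power2_norm_eq_inner inner_diff_left inner_diff_right inner_commute)
  have 2: "?r \<bullet> (A *v h) = (\<Sum>i\<in>UNIV. (transpose A *v ?r) $ i * h $ i)"
    using dot_lmul_matrix[of ?r A h] by (simp add: inner_vec_def)
  have 3: "(norm (x + h))\<^sup>2 = (norm x)\<^sup>2 + 2 * (\<Sum>i\<in>UNIV. x $ i * h $ i) + (norm h)\<^sup>2"
  proof -
    have "(norm (x + h))\<^sup>2 = (norm x)\<^sup>2 + 2 * (x \<bullet> h) + (norm h)\<^sup>2"
      by (simp add: power2_norm_eq_inner inner_add_left inner_add_right inner_commute)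
    then show ?thesis by (simp add: inner_vec_def)
  qed
  have 4: "(\<Sum>i\<in>UNIV. lam * d * (\<bar>x $ i + h $ i\<bar> - \<bar>x $ i\<bar>)
         - ((transpose A *v ?r) $ i + lam * x $ i) * h $ i)
    = lam * d * (l1norm (x + h) - l1norm x) - (\<Sum>i\<in>UNIV. (transpose A *v ?r) $ i * h $ i)
      - lam * (\<Sum>i\<in>UNIV. x $ i * h $ i)"
    unfolding l1norm_def
    by (simp add: sum_subtractf sum.distrib sum_distrib_left algebra_simps
        del: transpose_matrix_vector)
  show ?thesis
    unfolding objective_def 1 2 3 4 by (simp add: field_simps del: transpose_matrix_vector)
qed

lemma norm_le_outside_re_cone:
  fixes h :: "real ^ 'n"
  assumes "\<alpha> > 0" "h \<notin> re_cone \<alpha> S"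
  shows "norm h \<le> (1 + \<alpha>) / \<alpha> * (\<Sum>i\<in>- S. \<bar>h $ i\<bar>)"
proof -
  have "norm h \<le> (\<Sum>i\<in>UNIV. \<bar>h $ i\<bar>)" by (rule norm_le_l1_cart)
  also have "\<dots> = (\<Sum>i\<in>S. \<bar>h $ i\<bar>) + (\<Sum>i\<in>- S. \<bar>h $ i\<bar>)"
    by (subst sum.union_disjoint[symmetric]) auto
  also have "\<dots> \<le> (\<Sum>i\<in>- S. \<bar>h $ i\<bar>) / \<alpha> + (\<Sum>i\<in>- S. \<bar>h $ i\<bar>)"
    using assms by (simp add: re_cone_def field_simps)
  also have "\<dots> = (1 + \<alpha>) / \<alpha> * (\<Sum>i\<in>- S. \<bar>h $ i\<bar>)"
    using assms(1) by (simp add: field_simps)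
  finally show ?thesis .
qed

text \<open>
  The vector \<open>A\<^sup>T (y - A x)\<close> plays the role of a dual certificate: it satisfies the first-order
  condition on \<open>S\<close> and stays below \<open>\<lambda> d\<close> with a margin off \<open>S\<close>. The minimality holds against all
  points within \<open>2 \<epsilon>\<close>, whether or not they lie in the box.
\<close>

lemma objective_le_of_dual_certificate:
  fixes A :: "real ^ 'n ^ 'm"
  assumes "lam > 0" "\<alpha> > 0" "\<epsilon> > 0" "\<phi> > lam"
    and on: "\<And>i. i \<in> S \<Longrightarrow> (transpose A *v (y - A *v x)) $ i = lam * d * sgn (x $ i) - lam * x $ i"
    and off: "\<And>i. i \<notin> S \<Longrightarrow> x $ i = 0"
      "\<And>i. i \<notin> S \<Longrightarrow>
        \<bar>(transpose A *v (y - A *v x)) $ i\<bar> \<le> lam * d - lam * \<epsilon> * ((1 + \<alpha>) / \<alpha>)"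
    and RE: "restricted_eigenvalue \<alpha> \<phi> S A"
    and "d \<ge> 0" and near: "norm h \<le> 2 * \<epsilon>"
  shows "objective A y lam d x \<le> objective A y lam d (x + h)"
proof -
  let ?c = "lam * \<epsilon> * ((1 + \<alpha>) / \<alpha>)"
  let ?g = "transpose A *v (y - A *v x)"
  let ?f = "\<lambda>i. lam * d * (\<bar>x $ i + h $ i\<bar> - \<bar>x $ i\<bar>) - (?g $ i + lam * x $ i) * h $ i"
  define T where "T = (\<Sum>i\<in>- S. \<bar>h $ i\<bar>)"
  have "0 \<le> T" unfolding T_def by (simp add: sum_nonneg)
  have "0 \<le> ?f i" if "i \<in> S" for i
  proof -
    have "lam * d * (sgn (x $ i) * h $ i) \<le> lam * d * (\<bar>x $ i + h $ i\<bar> - \<bar>x $ i\<bar>)"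
      using \<open>lam > 0\<close> \<open>d \<ge> 0\<close> sgn_subgradient_abs[of "x $ i" "h $ i"]
      by (intro mult_left_mono) auto
    then show ?thesis unfolding on[OF that] by simp
  qed
  then have onS: "0 \<le> (\<Sum>i\<in>S. ?f i)" by (rule sum_nonneg)
  have "?c * \<bar>h $ i\<bar> \<le> ?f i" if "i \<in> - S" for i
  proof -
    have "?g $ i * h $ i \<le> \<bar>?g $ i\<bar> * \<bar>h $ i\<bar>"
      by (metis abs_ge_self abs_mult)
    also have "\<dots> \<le> (lam * d - ?c) * \<bar>h $ i\<bar>"
      using off(2) that by (intro mult_right_mono) auto
    finally show ?thesis using off(1) that by (simp add: left_diff_distrib)
  qed
  then have "?c * T \<le> (\<Sum>i\<in>- S. ?f i)"
    unfolding T_def sum_distrib_left by (rule sum_mono)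
  moreover have "(\<Sum>i\<in>UNIV. ?f i) = (\<Sum>i\<in>S. ?f i) + (\<Sum>i\<in>- S. ?f i)"
    by (subst sum.union_disjoint[symmetric]) auto
  ultimately have incr: "objective A y lam d (x + h) - objective A y lam d x
      \<ge> 1/2 * (norm (A *v h))\<^sup>2 - lam / 2 * (norm h)\<^sup>2 + ?c * T"
    using onS unfolding objective_increment by linarith
  have "0 \<le> 1/2 * (norm (A *v h))\<^sup>2 - lam / 2 * (norm h)\<^sup>2 + ?c * T"
  proof (cases "h \<in> re_cone \<alpha> S")
    case True
    have "lam * (norm h)\<^sup>2 \<le> \<phi> * (norm h)\<^sup>2"
      using \<open>\<phi> > lam\<close> by (intro mult_right_mono) auto
    also have "\<phi> * (norm h)\<^sup>2 \<le> (norm (A *v h))\<^sup>2"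
      using RE True unfolding restricted_eigenvalue_def by (cases "h = 0") auto
    finally have "lam * (norm h)\<^sup>2 \<le> (norm (A *v h))\<^sup>2" .
    moreover have "0 \<le> ?c * T"
      using \<open>lam > 0\<close> \<open>\<epsilon> > 0\<close> \<open>\<alpha> > 0\<close> \<open>0 \<le> T\<close> by simp
    ultimately show ?thesis by simp
  next
    case False
    have "(norm h)\<^sup>2 \<le> (2 * \<epsilon>) * ((1 + \<alpha>) / \<alpha> * T)"
      unfolding power2_eq_square T_def using near \<open>\<epsilon> > 0\<close>
      by (intro mult_mono norm_le_outside_re_cone[OF \<open>\<alpha> > 0\<close> False]) auto
    then have "lam / 2 * (norm h)\<^sup>2 \<le> lam / 2 * ((2 * \<epsilon>) * ((1 + \<alpha>) / \<alpha> * T))"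
      using \<open>lam > 0\<close> by (intro mult_left_mono) auto
    also have "\<dots> = ?c * T" by simp
    finally show ?thesis using zero_le_power2[of "norm (A *v h)"] by linarith
  qed
  then show ?thesis using incr by linarith
qed

section \<open>Local minimality of the candidate point\<close>

theorem theorem1:
  fixes A :: "real ^ 'n::finite ^ 'm::finite"
    and \<eta> y :: "real ^ 'm"
    and xt xs :: "real ^ 'n"
    and S :: "'n::finite set"
    and s :: "'k::finite \<Rightarrow> 'n"
    and t :: "'l::finite \<Rightarrow> 'n"
    and d lam \<mu> \<omega> \<alpha> \<phi> \<epsilon> :: real
  assumes dims: "CARD('m) < CARD('n)"
    and supp: "S = {i. xt $ i \<noteq> 0}"
    and card_S: "1 \<le> card S" "card S \<le> CARD('m)"
    and enum_S: "bij_betw s UNIV S"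
    and enum_compl: "bij_betw t UNIV (- S)"
    and d_pos: "d > 0"
    and xt_box: "xt \<in> cbox (vec (- d)) (vec d)"
    and mu: "\<mu> = (1 / d) * Min ((\<lambda>i. \<bar>xt $ i\<bar>) ` S)"
    and y: "y = A *v xt + \<eta>"
    and full_rank: "rank (subcols s A) = CARD('k)"
    and lam_pos: "lam > 0"
    and pd: "pos_def (shifted_gram lam (subcols s A))"
    and xs_box: "xs \<in> cbox (vec (- d)) (vec d)"
    and xs_compl: "subvec t xs = 0"
    and xs_S: "subvec s xs = subvec s xt +
          matrix_inv (shifted_gram lam (subcols s A)) *v
            (lam *\<^sub>R subvec s xt - (lam * d) *\<^sub>R sign_vec (subvec s xs)
              + transpose (subcols s A) *v \<eta>)"
    and sign_cond: "mat_norm_inf (matrix_inv (shifted_gram lam (subcols s A))) *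
          (lam * d * (1 - \<mu>) + infnorm (transpose (subcols s A) *v \<eta>)) \<le> \<mu> * d"
    and params_pos: "\<omega> > 0" "\<alpha> > 0" "\<phi> > 0" "\<epsilon> > 0"
    and C1: "irrepresentable \<omega> s t A"
    and C2: "restricted_eigenvalue \<alpha> \<phi> S A" "\<phi> > lam"
    and C3: "lam * d
          - (1 / \<omega>) *
              mat_norm_inf (gram (subcols s A) ** matrix_inv (shifted_gram lam (subcols s A))) *
              (lam * d * (1 - \<mu>) + infnorm (transpose (subcols s A) *v \<eta>))
          - infnorm (transpose (subcols t A) *v \<eta>)
          > lam * \<epsilon> * ((1 + \<alpha>) / \<alpha>)"
  shows "local_minimizer_on (cbox (vec (- d)) (vec d)) (objective A y lam d) xs"
proof -
  let ?B = "subcols s A" and ?C = "subcols t A"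
  let ?M = "shifted_gram lam (subcols s A)"
  let ?g = "transpose A *v (y - A *v xs)"
  define u where "u = subvec s xs"
  define w where "w = subvec s xt"
  define e where "e = transpose ?B *v \<eta>"
  define q where "q = lam *\<^sub>R w - (lam * d) *\<^sub>R sign_vec w + e"
  define Q where "Q = lam * d * (1 - \<mu>) + infnorm e"
  have sS: "s j \<in> S" for j using enum_S by (auto simp: bij_betw_def)
  have tS: "t j \<notin> S" for j using enum_compl by (auto simp: bij_betw_def)

  have w_le: "\<bar>w $ j\<bar> \<le> d" for j
    using xt_box by (auto simp: mem_box_cart w_def subvec_def abs_le_iff minus_le_iff)
  have w_ge: "\<mu> * d \<le> \<bar>w $ j\<bar>" for j
  proof -
    have "\<mu> * d = Min ((\<lambda>i. \<bar>xt $ i\<bar>) ` S)" using d_pos by (simp add: mu)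
    also have "\<dots> \<le> \<bar>xt $ s j\<bar>" using sS by (intro Min_le) auto
    finally show ?thesis by (simp add: w_def subvec_def)
  qed
  have w_nz: "w $ j \<noteq> 0" for j
    using sS[of j] by (simp add: w_def subvec_def supp)
  have sign_eq: "sign_vec u = sign_vec w"
  proof (rule candidate_sign_eq[OF pd lam_pos d_pos w_ge w_le w_nz])
    show "u = w + matrix_inv ?M *v (lam *\<^sub>R w - (lam * d) *\<^sub>R sign_vec u + e)"
      using xs_S unfolding u_def w_def e_def .
    show "mat_norm_inf (matrix_inv ?M) * (lam * d * (1 - \<mu>) + infnorm e) \<le> \<mu> * d"
      using sign_cond unfolding e_def .
  qed
  have u_eq: "u = w + matrix_inv ?M *v q"
    using xs_S unfolding u_def[symmetric] w_def[symmetric] e_def[symmetric] sign_eq q_def .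
  have q_le: "infnorm q \<le> Q"
    unfolding q_def Q_def using lam_pos
    by (intro infnorm_candidate_bracket_le w_ge w_le w_nz) auto

  have inv: "invertible ?M"
    using pd invertible_if_quadratic_form_pos unfolding pos_def_def by blast
  have "subvec t xt = 0"
    using tS by (simp add: vec_eq_iff subvec_def supp)
  then have "y - A *v xs = ?B *v w - ?B *v u + \<eta>"
    by (simp add: y matrix_vector_split_subcols[OF enum_S enum_compl] xs_compl u_def w_def)
  also have "?B *v w - ?B *v u = - (?B *v (matrix_inv ?M *v q))"
    by (simp add: u_eq matrix_vector_right_distrib)
  finally have res: "y - A *v xs = \<eta> - ?B *v (matrix_inv ?M *v q)" by simp

  have on: "?g $ i = lam * d * sgn (xs $ i) - lam * xs $ i" if i: "i \<in> S" for i
  proof -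
    obtain j where j: "i = s j" using i enum_S unfolding bij_betw_def by blast
    let ?v = "matrix_inv ?M *v q"
    have "?M *v ?v = q"
      by (simp add: matrix_vector_mul_assoc matrix_inv_inverse(1)[OF inv])
    then have "gram ?B *v ?v = q + lam *\<^sub>R ?v"
      by (simp add: shifted_gram_mult algebra_simps)
    then have "transpose ?B *v (y - A *v xs) = e - (q + lam *\<^sub>R ?v)"
      unfolding res gram_def e_def
      by (simp add: matrix_vector_mult_diff_distrib matrix_vector_mul_assoc matrix_mul_assoc
          del: transpose_matrix_vector)
    also have "\<dots> = (lam * d) *\<^sub>R sign_vec w - lam *\<^sub>R (w + ?v)"
      unfolding q_def by (simp add: algebra_simps)
    also have "\<dots> = (lam * d) *\<^sub>R sign_vec u - lam *\<^sub>R u"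
      by (simp only: sign_eq u_eq[symmetric])
    finally show ?thesis
      unfolding j transpose_subcols_component[symmetric]
      by (simp add: sign_vec_def u_def subvec_def del: transpose_matrix_vector)
  qed

  have off: "xs $ i = 0" "\<bar>?g $ i\<bar> \<le> lam * d - lam * \<epsilon> * ((1 + \<alpha>) / \<alpha>)"
    if i: "i \<notin> S" for i
  proof -
    obtain j where j: "i = t j" using i enum_compl unfolding bij_betw_def by blast
    show "xs $ i = 0" using xs_compl by (simp add: j vec_eq_iff subvec_def)
    let ?K = "pinv ?B ** ?C" and ?N = "gram ?B ** matrix_inv ?M"
    have K: "transpose ?K ** gram ?B = transpose ?C ** ?B"
      using transpose_pinv_mult_gram invertible_gram_if_pos_def_shifted[OF pd] lam_pos by simp
    have "transpose ?C *v (y - A *v xs)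
        = transpose ?C *v \<eta> - (transpose ?C ** ?B) *v (matrix_inv ?M *v q)"
      unfolding res
      by (simp add: matrix_vector_mult_diff_distrib matrix_vector_mul_assoc matrix_mul_assoc
          del: transpose_matrix_vector)
    also have "(transpose ?C ** ?B) *v (matrix_inv ?M *v q) = transpose ?K *v (?N *v q)"
      unfolding K[symmetric]
      by (simp add: matrix_vector_mul_assoc matrix_mul_assoc del: transpose_matrix_vector)
    finally have g: "?g $ i = (transpose ?C *v \<eta>) $ j - (transpose ?K *v (?N *v q)) $ j"
      unfolding j transpose_subcols_component[symmetric] by simp
    have Nq: "infnorm (?N *v q) \<le> mat_norm_inf ?N * Q"
    proof (rule infnorm_le_cart)
      fix l
      have "\<bar>(?N *v q) $ l\<bar> \<le> mat_norm_inf ?N * infnorm q"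
        by (rule abs_matrix_vector_le_mat_norm_inf)
      also have "\<dots> \<le> mat_norm_inf ?N * Q"
        using q_le by (intro mult_left_mono mat_norm_inf_nonneg)
      finally show "\<bar>(?N *v q) $ l\<bar> \<le> mat_norm_inf ?N * Q" .
    qed
    have "\<bar>(transpose ?K *v (?N *v q)) $ j\<bar> \<le> mat_norm_1 ?K * infnorm (?N *v q)"
      unfolding mat_norm_inf_transpose[symmetric] by (rule abs_matrix_vector_le_mat_norm_inf)
    also have "\<dots> \<le> (1 / \<omega>) * (mat_norm_inf ?N * Q)"
      using C1 Nq params_pos(1) unfolding irrepresentable_def
      by (intro mult_mono) (auto simp: infnorm_pos_le)
    finally have "\<bar>(transpose ?K *v (?N *v q)) $ j\<bar> \<le> (1 / \<omega>) * mat_norm_inf ?N * Q"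
      by (simp add: mult.assoc)
    moreover have "\<bar>(transpose ?C *v \<eta>) $ j\<bar> \<le> infnorm (transpose ?C *v \<eta>)"
      by (rule component_le_infnorm_cart)
    ultimately show "\<bar>?g $ i\<bar> \<le> lam * d - lam * \<epsilon> * ((1 + \<alpha>) / \<alpha>)"
      using C3 unfolding g Q_def e_def by linarith
  qed

  have "objective A y lam d xs \<le> objective A y lam d z" if "dist z xs < 2 * \<epsilon>" for z
  proof -
    have "objective A y lam d xs \<le> objective A y lam d (xs + (z - xs))"
      by (rule objective_le_of_dual_certificate[OF lam_pos params_pos(2,4) C2(2) on off C2(1)])
         (use d_pos that in \<open>auto simp: dist_norm\<close>)
    then show ?thesis by simp
  qed
  moreover have "2 * \<epsilon> > 0" using params_pos(4) by simp
  ultimately show ?thesis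
    unfolding local_minimizer_on_def using xs_box by blast
qed

end
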